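(* Let ${\rm P}_0\in\mathbb R_+$, $\bar p\in\,]3/2,2]$, ${\rm S}_0\in\mathbb R_+^*$, and let ${\rm U}_0=({\rm f}_0,{\rm E}_0,{\rm B}_0)\in\mathfrak N$ be initial data for the Relativistic Vlasov-Maxwell system with $\mathcal N({\rm U}_0)\le{\rm S}_0$. Let $\mathcal T({\rm S}_0)$ and $\mathcal F({\rm S}_0;\cdot)$ be the time and the function controlling the momentum support (see context). Let $q\in\mathbb N^*$. Then, for all ${\rm G}\in L^\infty(\mathbb R^3;\mathbb R^q)$, the macroscopic quantity $${\rm M}_{\rm G}(t,x):=\int_{\mathbb R^3}{\rm G}(\xi)\,{\rm f}(t,x,\xi)\,d\xi$$ satisfies $$\forall\,(t,x)\in[0,\mathcal T({\rm S}_0)]\times\mathbb R^3,\qquad\|{\rm M}_{\rm G}(t,x)\|\le4\pi\,{\rm S}_0\,\mathcal F({\rm S}_0;t)^3\sup_{|\xi|\le\mathcal F({\rm S}_0;t)}\|{\rm G}(\xi)\|<+\infty.$$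
   Context: Notation: $\mathbb R_+=[0,\infty[$, $\mathbb R_+^*=]0,\infty[$; $\langle\xi\rangle:=\sqrt{1+|\xi|^2}$, $\nu(\xi):=\xi/\langle\xi\rangle$; $B(0,R]$ is the closed ball of $\mathbb R^3$ of radius $R$ centered at $0$. The Relativistic Vlasov-Maxwell system, for ${\rm f}(t,x,\xi)\in\mathbb R_+$, ${\rm E}(t,x),{\rm B}(t,x)\in\mathbb R^3$, is $$\partial_t{\rm f}+\nu(\xi)\cdot\nabla_x{\rm f}+\bigl({\rm E}+\nu(\xi)\times{\rm B}\bigr)\cdot\nabla_\xi{\rm f}=0,$$ $$\partial_t{\rm E}-\nabla_x\times{\rm B}=-\int_{\mathbb R^3}\nu(\xi){\rm f}\,d\xi,\quad\nabla_x\cdot{\rm E}=\int_{\mathbb R^3}{\rm f}\,d\xi-\rho,\quad\partial_t{\rm B}+\nabla_x\times{\rm E}=0,\quad\nabla_x\cdot{\rm B}=0,$$ with $\rho\in C^1_c(\mathbb R^3;\mathbb R_+)$ given, and initial data ${\rm U}_0=({\rm f}_0,{\rm E}_0,{\rm B}_0)$ always assumed to satisfy ${\rm f}_0\ge0$, $\nabla_x\cdot{\rm E}_0=\int{\rm f}_0\,d\xi-\rho$, $\nabla_x\cdot{\rm B}_0=0$. Moreover $$\mathfrak N:=\bigl\{{\rm U}_0\in C^1_c(\mathbb R^3\times\mathbb R^3)\times C^2_c(\mathbb R^3)\times C^2_c(\mathbb R^3)\ ;\ \operatorname{supp}{\rm f}_0\subset\mathbb R^3\times B(0,{\rm P}_0]\bigr\},$$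 $$\mathcal N({\rm U}_0):=\|{\rm f}_0\|_{L^\infty}+\|{\rm E}_0\|_{W^{1,\bar p}}+\|{\rm B}_0\|_{W^{1,\bar p}}.$$ $T({\rm U}_0)\in\,]0,+\infty]$ is the maximal lifespan of the smooth solution $({\rm f},{\rm E},{\rm B})$ with data ${\rm U}_0$, and ${\rm P}(t):=\inf\{R\in\mathbb R_+\,;\,{\rm f}(t,x,\xi)=0\ \text{for all }x\in\mathbb R^3\text{ and all }|\xi|\ge R\}$. $\mathcal T({\rm S}_0)\in\mathbb R_+^*$ and the continuous increasing function $\mathcal F({\rm S}_0;\cdot):[0,\mathcal T({\rm S}_0)]\to\mathbb R_+$ depend only on ${\rm S}_0$ (with ${\rm P}_0,\bar p$ fixed) and are such that, for all initial data ${\rm U}_0\in\mathfrak N$ with $\mathcal N({\rm U}_0)\le{\rm S}_0$, ${\rm P}(t)\le\mathcal F({\rm S}_0;t)$ for all $t\in[0,\min(T({\rm U}_0);\mathcal T({\rm S}_0))[$. One has $\mathcal T({\rm S}_0)\le T({\rm U}_0)$, so that the smooth solution does exist on this time interval. *)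

theory Defs
  imports "HOL-Analysis.Analysis" "HOL-Probability.Essential_Supremum"
begin

type_synonym R3 = "real ^ 3"

section \<open>Regularity and norms\<close>

text \<open>Derivatives are taken within \<open>S\<close>, so that they are one-sided at the end points of a time
  interval; \<open>S\<close> will be the whole space or a non-degenerate interval times a whole space, where
  derivatives within \<open>S\<close> are unique.\<close>

definition C1_on :: "'a::real_normed_vector set \<Rightarrow> ('a \<Rightarrow> 'b::real_normed_vector) \<Rightarrow> bool" where
  "C1_on S g \<longleftrightarrow> (\<exists>D :: 'a \<Rightarrow> 'a \<Rightarrow>\<^sub>L 'b. continuous_on S D \<and>
     (\<forall>x\<in>S. (g has_derivative blinfun_apply (D x)) (at x within S)))"

definition C2_on :: "'a::real_normed_vector set \<Rightarrow> ('a \<Rightarrow> 'b::real_normed_vector) \<Rightarrow> bool" where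
  "C2_on S g \<longleftrightarrow> (\<exists>D :: 'a \<Rightarrow> 'a \<Rightarrow>\<^sub>L 'b. C1_on S D \<and>
     (\<forall>x\<in>S. (g has_derivative blinfun_apply (D x)) (at x within S)))"

definition supp :: "('a::topological_space \<Rightarrow> 'b::zero) \<Rightarrow> 'a set" where
  "supp g = closure {x. g x \<noteq> 0}"

definition C1c :: "('a::real_normed_vector \<Rightarrow> 'b::real_normed_vector) set" where
  "C1c = {g. C1_on UNIV g \<and> compact (supp g)}"

definition C2c :: "('a::real_normed_vector \<Rightarrow> 'b::real_normed_vector) set" where
  "C2c = {g. C2_on UNIV g \<and> compact (supp g)}"

text \<open>Because it takes values in \<^typ>\<open>ennreal\<close>, the essential supremum over a null set is \<open>0\<close>.\<close>

definition Linf_norm :: "'a measure \<Rightarrow> ('a \<Rightarrow> 'b::real_normed_vector) \<Rightarrow> ennreal" where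
  "Linf_norm M g = esssup M (\<lambda>x. ennreal (norm (g x)))"

definition Linf :: "('a::euclidean_space \<Rightarrow> 'b::real_normed_vector) set" where
  "Linf = {g. g \<in> borel_measurable lebesgue \<and> Linf_norm lebesgue g < \<infinity>}"

definition pd :: "3 \<Rightarrow> (R3 \<Rightarrow> 'b::real_normed_vector) \<Rightarrow> R3 \<Rightarrow> 'b" where
  "pd i g x = frechet_derivative g (at x) (axis i 1)"

text \<open>The \<open>W\<^sup>1\<^sup>,\<^sup>p\<close> norm, written with classical derivatives: it is only applied to \<open>C\<^sup>2\<close> fields with
  compact support, for which weak and classical derivatives agree and all integrals are finite.\<close>

definition W1_norm :: "real \<Rightarrow> (R3 \<Rightarrow> R3) \<Rightarrow> real" where
  "W1_norm p F = ((\<integral>x. norm (F x) powr p \<partial>lebesgue)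
     + (\<Sum>i\<in>UNIV. \<integral>x. norm (pd i F x) powr p \<partial>lebesgue)) powr (1 / p)"

section \<open>The relativistic Vlasov-Maxwell system\<close>

definition grad :: "(R3 \<Rightarrow> real) \<Rightarrow> R3 \<Rightarrow> R3" where
  "grad g x = (\<chi> i. pd i g x)"

definition divg :: "(R3 \<Rightarrow> R3) \<Rightarrow> R3 \<Rightarrow> real" where
  "divg F x = (\<Sum>i\<in>UNIV. pd i F x $ i)"

definition curl :: "(R3 \<Rightarrow> R3) \<Rightarrow> R3 \<Rightarrow> R3" where
  "curl F x = vector [pd 2 F x $ 3 - pd 3 F x $ 2,
                      pd 3 F x $ 1 - pd 1 F x $ 3,
                      pd 1 F x $ 2 - pd 2 F x $ 1]"

definition japanese :: "R3 \<Rightarrow> real" where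
  "japanese \<xi> = sqrt (1 + (norm \<xi>)\<^sup>2)"

definition vel :: "R3 \<Rightarrow> R3" where
  "vel \<xi> = \<xi> /\<^sub>R japanese \<xi>"

type_synonym data = "(R3 \<Rightarrow> R3 \<Rightarrow> real) \<times> (R3 \<Rightarrow> R3) \<times> (R3 \<Rightarrow> R3)"

definition admissible :: "(R3 \<Rightarrow> real) \<Rightarrow> data \<Rightarrow> bool" where
  "admissible \<rho> U0 = (case U0 of (f0, E0, B0) \<Rightarrow>
     (\<forall>x \<xi>. 0 \<le> f0 x \<xi>) \<and>
     (\<forall>x. divg E0 x = (\<integral>\<xi>. f0 x \<xi> \<partial>lebesgue) - \<rho> x) \<and>
     (\<forall>x. divg B0 x = 0))"

definition data_class :: "real \<Rightarrow> data set" (\<open>\<NN>\<close>) where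
  "\<NN> P0 = {(f0, E0, B0). (\<lambda>(x, \<xi>). f0 x \<xi>) \<in> C1c \<and> E0 \<in> C2c \<and> B0 \<in> C2c \<and>
     supp (\<lambda>(x, \<xi>). f0 x \<xi>) \<subseteq> UNIV \<times> cball 0 P0}"

definition data_norm :: "real \<Rightarrow> data \<Rightarrow> ennreal" (\<open>\<N>\<close>) where
  "\<N> p U0 = (case U0 of (f0, E0, B0) \<Rightarrow>
     Linf_norm lebesgue (\<lambda>(x, \<xi>). f0 x \<xi>) + ennreal (W1_norm p E0) + ennreal (W1_norm p B0))"

text \<open>Smooth solutions on a time interval \<open>I\<close> starting at \<open>0\<close> are the \<open>C\<^sup>1\<close> solutions whose
  momentum support is bounded locally uniformly in time. This is the class in which the Cauchy
  problem has a unique solution; the bound on the momentum support also makes the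
  charge and current densities well defined.\<close>

definition smooth_solution ::
  "(R3 \<Rightarrow> real) \<Rightarrow> data \<Rightarrow> real set \<Rightarrow> (real \<Rightarrow> R3 \<Rightarrow> R3 \<Rightarrow> real) \<Rightarrow>
   (real \<Rightarrow> R3 \<Rightarrow> R3) \<Rightarrow> (real \<Rightarrow> R3 \<Rightarrow> R3) \<Rightarrow> bool" where
  "smooth_solution \<rho> U0 I f E B \<longleftrightarrow>
     C1_on (I \<times> UNIV \<times> UNIV) (\<lambda>(t, x, \<xi>). f t x \<xi>) \<and>
     C1_on (I \<times> UNIV) (\<lambda>(t, x). E t x) \<and>
     C1_on (I \<times> UNIV) (\<lambda>(t, x). B t x) \<and>
     (\<forall>t\<in>I. \<forall>x \<xi>. 0 \<le> f t x \<xi>) \<and>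
     (\<forall>s\<in>I. \<exists>R. \<forall>t\<in>{0..s}. \<forall>x \<xi>. R \<le> norm \<xi> \<longrightarrow> f t x \<xi> = 0) \<and>
     (f 0, E 0, B 0) = U0 \<and>
     (\<forall>t\<in>I. \<forall>x \<xi>.
        vector_derivative (\<lambda>s. f s x \<xi>) (at t within I)
        + vel \<xi> \<bullet> grad (\<lambda>y. f t y \<xi>) x
        + (E t x + cross3 (vel \<xi>) (B t x)) \<bullet> grad (\<lambda>\<eta>. f t x \<eta>) \<xi> = 0) \<and>
     (\<forall>t\<in>I. \<forall>x.
        vector_derivative (\<lambda>s. E s x) (at t within I) - curl (B t) x
          = - (\<integral>\<xi>. f t x \<xi> *\<^sub>R vel \<xi> \<partial>lebesgue) \<and>
        divg (E t) x = (\<integral>\<xi>. f t x \<xi> \<partial>lebesgue) - \<rho> x \<and>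
        vector_derivative (\<lambda>s. B s x) (at t within I) + curl (E t) x = 0 \<and>
        divg (B t) x = 0)"

definition lifespan :: "(R3 \<Rightarrow> real) \<Rightarrow> data \<Rightarrow> ereal" where
  "lifespan \<rho> U0 = Sup {ereal T | T. 0 < T \<and> (\<exists>f E B. smooth_solution \<rho> U0 {0..<T} f E B)}"

definition maximal_solution ::
  "(R3 \<Rightarrow> real) \<Rightarrow> data \<Rightarrow> (real \<Rightarrow> R3 \<Rightarrow> R3 \<Rightarrow> real) \<Rightarrow>
   (real \<Rightarrow> R3 \<Rightarrow> R3) \<Rightarrow> (real \<Rightarrow> R3 \<Rightarrow> R3) \<Rightarrow> bool" where
  "maximal_solution \<rho> U0 f E B \<longleftrightarrow>
     smooth_solution \<rho> U0 {t. 0 \<le> t \<and> ereal t < lifespan \<rho> U0} f E B"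

definition momentum_radius :: "(real \<Rightarrow> R3 \<Rightarrow> R3 \<Rightarrow> real) \<Rightarrow> real \<Rightarrow> ereal" where
  "momentum_radius f t = Inf {ereal R | R. 0 \<le> R \<and> (\<forall>x \<xi>. R \<le> norm \<xi> \<longrightarrow> f t x \<xi> = 0)}"

definition momentum_control ::
  "(R3 \<Rightarrow> real) \<Rightarrow> real \<Rightarrow> real \<Rightarrow> real \<Rightarrow> real \<Rightarrow> (real \<Rightarrow> real) \<Rightarrow> bool" where
  "momentum_control \<rho> P0 p S0 \<T> \<F> \<longleftrightarrow>
     0 < \<T> \<and> continuous_on {0..\<T>} \<F> \<and> mono_on {0..\<T>} \<F> \<and> (\<forall>t\<in>{0..\<T>}. 0 \<le> \<F> t) \<and>
     (\<forall>U0\<in>\<NN> P0. admissible \<rho> U0 \<longrightarrow> \<N> p U0 \<le> ennreal S0 \<longrightarrow>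
        ereal \<T> \<le> lifespan \<rho> U0 \<and>
        (\<forall>f E B. maximal_solution \<rho> U0 f E B \<longrightarrow>
           (\<forall>t. 0 \<le> t \<and> ereal t < min (lifespan \<rho> U0) (ereal \<T>) \<longrightarrow>
              momentum_radius f t \<le> ereal (\<F> t))))"

definition macroscopic ::
  "(R3 \<Rightarrow> 'b::{banach, second_countable_topology}) \<Rightarrow> (real \<Rightarrow> R3 \<Rightarrow> R3 \<Rightarrow> real) \<Rightarrow> real \<Rightarrow> R3 \<Rightarrow> 'b" where
  "macroscopic G f t x = (\<integral>\<xi>. f t x \<xi> *\<^sub>R G \<xi> \<partial>lebesgue)"

end

theory Submission
  imports Defs
begin

text \<open>Two facts about the density give the bound at once: \<open>0 \<le> f \<le> S0\<close> everywhere, and \<open>f t x\<close> vanishes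
  outside the ball of radius \<open>\<F> S0 t\<close>. The integrand is then at most \<open>S0\<close> times the essential supremum
  of \<open>G\<close> on that ball, whose volume is \<open>4 / 3 * pi * (\<F> S0 t) ^ 3\<close>
  (\<open>norm_integral_cball_le\<close>); the constant \<open>4 * pi\<close> of the theorem leaves a factor of three to spare.

  The upper bound on \<open>f\<close> is usually read off from the constancy of \<open>f\<close> along the characteristics.
  Here it comes from a maximum principle (\<open>transport_maximum_principle\<close>) that uses only the
  directions of the characteristics, not the curves themselves. The fields may be unbounded in space, but speeds are at most
  \<open>1\<close>, so a backward light cone is stable under following the characteristic directions into the
  past, and together with the bounded momentum support it is compact. After subtraction of
  a small multiple of \<open>t\<close>, the density strictly increases at first into the past along the straight line
  tangent to the characteristic; hence its maximum on this set is attained at time \<open>0\<close> or where \<open>f\<close>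
  vanishes. At time \<open>0\<close> the bound holds at every point, not merely almost everywhere, because the initial
  density is continuous (\<open>continuous_norm_le_of_Linf_norm_le\<close>).

  The support property for \<open>t < \<T> S0\<close> is the hypothesis on the momentum radius. At the end
  point it follows by continuity in time, since \<open>\<F> S0\<close> is monotone.\<close>

section \<open>A maximum principle for transport equations of bounded speed\<close>

text \<open>The compact set \<open>W\<close> is the part with momenta in the ball of radius \<open>R\<close> of the backward
  light cone with vertex \<open>(t1, x1)\<close>, cut off at time \<open>0\<close>. Moving from \<open>(t, x)\<close> back in time along \<open>- v \<xi>\<close> does
  not leave the cone, because the cone widens at speed \<open>1\<close>. Only the
  momentum boundary could be crossed, and \<open>f\<close> vanishes there. The force \<open>K\<close> enters only through its
  value at the maximum point.\<close>

lemma transport_maximum_principle: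
  fixes f :: "real \<Rightarrow> 'a::euclidean_space \<Rightarrow> 'b::euclidean_space \<Rightarrow> real"
  assumes der: "\<And>t x \<xi>. t \<in> {0..T} \<Longrightarrow>
      ((\<lambda>(t, x, \<xi>). f t x \<xi>) has_derivative D t x \<xi>) (at (t, x, \<xi>) within {0..T} \<times> UNIV \<times> UNIV)"
    and transport: "\<And>t x \<xi>. t \<in> {0..T} \<Longrightarrow> D t x \<xi> (1, v \<xi>, K t x \<xi>) = 0"
    and speed: "\<And>\<xi>. norm (v \<xi>) \<le> 1"
    and supp: "\<And>t x \<xi>. t \<in> {0..T} \<Longrightarrow> R \<le> norm \<xi> \<Longrightarrow> f t x \<xi> = 0"
    and init: "\<And>x \<xi>. f 0 x \<xi> \<le> M" and M: "0 \<le> M"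
    and t1: "t1 \<in> {0..T}"
  shows "f t1 x1 \<xi>1 \<le> M"
proof (cases "R \<le> norm \<xi>1")
  case True
  then show ?thesis using supp t1 M by simp
next
  case False
  have penalised: "f t1 x1 \<xi>1 - \<delta> * t1 \<le> M" if \<delta>: "0 < \<delta>" for \<delta>
  proof -
    define h where "h = (\<lambda>(t, x, \<xi>). f t x \<xi> - \<delta> * t)"
    define W where "W = {z :: real \<times> 'a \<times> 'b. 0 \<le> fst z \<and> norm (fst (snd z) - x1) \<le> t1 - fst z
      \<and> norm (snd (snd z)) \<le> R}"
    have W_sub: "W \<subseteq> {0..T} \<times> UNIV \<times> UNIV"
    proof
      fix z assume "z \<in> W"
      moreover from this have "0 \<le> t1 - fst z" unfolding W_def using norm_ge_zero order_trans by blast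
      ultimately show "z \<in> {0..T} \<times> UNIV \<times> UNIV" using t1 by (cases z) (auto simp: W_def)
    qed
    have "W \<subseteq> {0..t1} \<times> cball x1 t1 \<times> cball 0 R"
    proof
      fix z assume z: "z \<in> W"
      moreover from this have "0 \<le> t1 - fst z" unfolding W_def using norm_ge_zero order_trans by blast
      ultimately show "z \<in> {0..t1} \<times> cball x1 t1 \<times> cball 0 R"
        by (cases z) (auto simp: W_def dist_norm norm_minus_commute)
    qed
    moreover have "bounded ({0..t1} \<times> cball x1 t1 \<times> cball (0::'b) R)"
      by (intro bounded_Times bounded_cball bounded_closed_interval)
    ultimately have "bounded W" using bounded_subset by blast
    moreover have "closed W" unfolding W_def
      by (intro closed_Collect_conj closed_Collect_le continuous_intros)
    ultimately have "compact W" by (simp add: compact_eq_bounded_closed)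
    moreover have "continuous_on W h"
    proof -
      have "continuous_on ({0..T} \<times> UNIV \<times> UNIV) (\<lambda>(t, x, \<xi>). f t x \<xi>)"
        by (rule has_derivative_continuous_on[where f' = "\<lambda>(t, x, \<xi>). D t x \<xi>"])
          (auto simp del: UNIV_Times_UNIV intro: der)
      then have "continuous_on W (\<lambda>z. (\<lambda>(t, x, \<xi>). f t x \<xi>) z - \<delta> * fst z)"
        by (intro continuous_intros continuous_on_subset[OF _ W_sub])
      then show ?thesis by (simp add: h_def case_prod_unfold)
    qed
    moreover have top: "(t1, x1, \<xi>1) \<in> W" using False t1 by (simp add: W_def)
    ultimately obtain z where z: "z \<in> W" and z_max: "\<And>y. y \<in> W \<Longrightarrow> h y \<le> h z"
      using continuous_attains_sup[of W h] by blast
    obtain t x \<xi> where z_eq: "z = (t, x, \<xi>)" by (cases z)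
    have t: "0 \<le> t" "t \<in> {0..T}" and cone: "norm (x - x1) \<le> t1 - t" and \<xi>: "norm \<xi> \<le> R"
      using z subsetD[OF W_sub z] by (simp_all add: z_eq W_def)
    have "h z \<le> M"
    proof (cases "t = 0 \<or> norm \<xi> = R")
      case True
      then have "f t x \<xi> \<le> M" using init supp[OF t(2), of \<xi> x] M by auto
      moreover have "0 \<le> \<delta> * t" using \<delta> t by simp
      ultimately show ?thesis by (simp add: h_def z_eq)
    next
      case False
      then have "0 < t" and "norm \<xi> < R" using t \<xi> by auto
      \<comment> \<open>The straight line into the past, tangent to the characteristic through the maximum point.\<close>
      define \<gamma> where "\<gamma> s = (t - s, x - s *\<^sub>R v \<xi>, \<xi> - s *\<^sub>R K t x \<xi>)" for s
      have der_\<gamma>: "(\<gamma> has_derivative (\<lambda>s. s *\<^sub>R (- (1, v \<xi>, K t x \<xi>)))) (at 0 within {0..t})"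
        unfolding \<gamma>_def by (auto intro!: derivative_eq_intros)
      have "bounded_linear (D t x \<xi>)" using der[OF t(2)] has_derivative_bounded_linear by blast
      then have D_lin: "D t x \<xi> (s *\<^sub>R (- (1, v \<xi>, K t x \<xi>))) = 0" for s
        using transport[OF t(2)]
        by (metis (no_types, lifting) bounded_linear.linear linear_neg linear_scale scaleR_zero_right neg_equal_0_iff_equal)
      have "\<gamma> ` {0..t} \<subseteq> {0..T} \<times> UNIV \<times> UNIV" using t by (auto simp: \<gamma>_def)
      moreover have "\<gamma> 0 = (t, x, \<xi>)" by (simp add: \<gamma>_def)
      ultimately have "((\<lambda>(t, x, \<xi>). f t x \<xi>) has_derivative D t x \<xi>) (at (\<gamma> 0) within \<gamma> ` {0..t})"
        using der[OF t(2)] has_derivative_subset by metis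
      from diff_chain_within[OF der_\<gamma> this]
      have "(((\<lambda>(t, x, \<xi>). f t x \<xi>) \<circ> \<gamma>) has_derivative (\<lambda>s. 0)) (at 0 within {0..t})"
        by (simp only: o_def D_lin)
      moreover have "((\<lambda>s. \<delta> * (t - s)) has_derivative (\<lambda>s. \<delta> * (0 - s))) (at 0 within {0..t})"
        by (intro derivative_intros)
      ultimately have "((\<lambda>s. ((\<lambda>(t, x, \<xi>). f t x \<xi>) \<circ> \<gamma>) s - \<delta> * (t - s)) has_derivative
          (\<lambda>s. 0 - \<delta> * (0 - s))) (at 0 within {0..t})"
        by (rule has_derivative_diff)
      moreover have "(\<lambda>s. ((\<lambda>(t, x, \<xi>). f t x \<xi>) \<circ> \<gamma>) s - \<delta> * (t - s)) = h \<circ> \<gamma>"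
        by (auto simp: h_def \<gamma>_def)
      ultimately have "((h \<circ> \<gamma>) has_real_derivative \<delta>) (at 0 within {0..t})"
        by (simp add: has_field_derivative_def)
      from has_real_derivative_pos_inc_right[OF this \<delta>]
      obtain d where d: "d > 0" "\<And>s. s > 0 \<Longrightarrow> s \<in> {0..t} \<Longrightarrow> s < d \<Longrightarrow> h (\<gamma> 0) < h (\<gamma> s)"
        by auto
      have "((\<lambda>s. norm (\<xi> - s *\<^sub>R K t x \<xi>)) \<longlongrightarrow> norm (\<xi> - 0 *\<^sub>R K t x \<xi>)) (at_right 0)"
        by (intro tendsto_intros)
      then have "\<forall>\<^sub>F s in at_right 0. norm (\<xi> - s *\<^sub>R K t x \<xi>) < R"
        using \<open>norm \<xi> < R\<close> order_tendstoD(2) by fastforce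
      moreover have "\<forall>\<^sub>F s in at_right 0. s < min d t"
        using d \<open>0 < t\<close> by (intro eventually_at_rightI[of 0 "min d t"]) auto
      moreover have "\<forall>\<^sub>F s in at_right (0::real). 0 < s" by (rule eventually_at_right_less)
      ultimately have "\<forall>\<^sub>F s in at_right 0. norm (\<xi> - s *\<^sub>R K t x \<xi>) < R \<and> s < min d t \<and> 0 < s"
        by eventually_elim simp
      then obtain s where s: "norm (\<xi> - s *\<^sub>R K t x \<xi>) < R" "s < d" "s < t" "0 < s"
        using eventually_happens'[OF trivial_limit_at_right_real] by fastforce
      have "norm (x - s *\<^sub>R v \<xi> - x1) \<le> norm (x - x1) + norm (s *\<^sub>R v \<xi>)"
        using norm_triangle_ineq4[of "x - x1" "s *\<^sub>R v \<xi>"] by (simp add: algebra_simps)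
      also have "norm (s *\<^sub>R v \<xi>) \<le> s" using s speed[of \<xi>] by (simp add: mult_left_le)
      finally have "\<gamma> s \<in> W" using cone s by (simp add: W_def \<gamma>_def)
      with z_max have "h (\<gamma> s) \<le> h (\<gamma> 0)" by (simp add: z_eq \<gamma>_def)
      with d(2)[of s] s show ?thesis by simp
    qed
    with z_max[OF top] show ?thesis by (simp add: h_def)
  qed
  \<comment> \<open>The denominator is \<open>T + 1\<close> rather than \<open>T\<close>, since \<open>T = 0\<close> is possible.\<close>
  have "f t1 x1 \<xi>1 \<le> M + e" if "0 < e" for e
  proof -
    have "e * t1 \<le> e * (T + 1)" using that t1 by (intro mult_left_mono) auto
    then have "e / (T + 1) * t1 \<le> e" using t1 by (simp add: pos_divide_le_eq)
    with penalised[of "e / (T + 1)"] that t1 show ?thesis by auto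
  qed
  then show ?thesis by (rule field_le_epsilon)
qed

section \<open>The pointwise bound on the density\<close>

lemma norm_vel_le_1: "norm (vel \<xi>) \<le> 1"
proof -
  have "norm \<xi> \<le> japanese \<xi>" unfolding japanese_def by (rule real_le_rsqrt) simp
  moreover have "0 < japanese \<xi>" by (simp add: japanese_def add_pos_nonneg)
  ultimately show ?thesis by (simp add: vel_def field_simps)
qed

lemma C1_on_imp_continuous_on: "C1_on S g \<Longrightarrow> continuous_on S g"
  unfolding C1_on_def by (auto intro: has_derivative_continuous_on)

lemma inner_grad:
  fixes g :: "R3 \<Rightarrow> real"
  assumes "(g has_derivative g') (at x)"
  shows "w \<bullet> grad g x = g' w"
proof -
  have lin: "linear g'" using assms has_derivative_linear by blast
  have "g' w = g' (\<Sum>i\<in>UNIV. w $ i *\<^sub>R axis i 1)"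
    by (simp add: basis_expansion scalar_mult_eq_scaleR[symmetric])
  also have "\<dots> = (\<Sum>i\<in>UNIV. w $ i * g' (axis i 1))"
    by (simp add: linear_sum[OF lin] linear_scale[OF lin])
  also have "\<dots> = w \<bullet> grad g x"
    by (simp add: inner_vec_def grad_def pd_def frechet_derivative_at[OF assms, symmetric])
  finally show ?thesis by simp
qed

text \<open>The Vlasov equation is written with partial derivatives. Since the density is continuously
  differentiable in all variables jointly, they are the values of one total derivative, and the equation
  says that this derivative vanishes in the characteristic direction. The condition \<open>0 < T\<close> makes
  one-sided time derivatives unique.\<close>

lemma smooth_solution_transport:
  assumes sol: "smooth_solution \<rho> U0 {0..T} f E B" and T: "0 < T"
  obtains D where
    "\<And>t x \<xi>. t \<in> {0..T} \<Longrightarrow>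
      ((\<lambda>(t, x, \<xi>). f t x \<xi>) has_derivative D t x \<xi>) (at (t, x, \<xi>) within {0..T} \<times> UNIV \<times> UNIV)"
    "\<And>t x \<xi>. t \<in> {0..T} \<Longrightarrow> D t x \<xi> (1, vel \<xi>, E t x + cross3 (vel \<xi>) (B t x)) = 0"
proof -
  let ?S = "{0..T} \<times> (UNIV :: R3 set) \<times> (UNIV :: R3 set)"
  let ?g = "\<lambda>(t, x, \<xi>). f t x \<xi>"
  have "C1_on ?S ?g" using sol by (simp add: smooth_solution_def)
  then obtain D' where D': "\<And>z. z \<in> ?S \<Longrightarrow> (?g has_derivative blinfun_apply (D' z)) (at z within ?S)"
    unfolding C1_on_def by blast
  define D where "D t x \<xi> = blinfun_apply (D' (t, x, \<xi>))" for t x \<xi>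
  have der: "(?g has_derivative D t x \<xi>) (at (t, x, \<xi>) within ?S)" if "t \<in> {0..T}" for t x \<xi>
    using D'[of "(t, x, \<xi>)"] that by (simp add: D_def)
  have "D t x \<xi> (1, vel \<xi>, E t x + cross3 (vel \<xi>) (B t x)) = 0" if t: "t \<in> {0..T}" for t x \<xi>
  proof -
    let ?K = "E t x + cross3 (vel \<xi>) (B t x)"
    have lin: "linear (D t x \<xi>)" using der[OF t] has_derivative_linear by blast
    \<comment> \<open>The partial derivatives, obtained by composing with the three coordinate embeddings \<open>\<phi>\<close>.\<close>
    have chain: "((?g \<circ> \<phi>) has_derivative (D t x \<xi> \<circ> \<phi>')) (at a within A)"
      if "(\<phi> has_derivative \<phi>') (at a within A)" "\<phi> a = (t, x, \<xi>)" "\<phi> ` A \<subseteq> ?S"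
      for \<phi> :: "'z::real_normed_vector \<Rightarrow> _" and \<phi>' a A
      using diff_chain_within[OF that(1)] has_derivative_subset[OF der[OF t] that(3)] that(2) by metis
    have "((?g \<circ> (\<lambda>s. (s, x, \<xi>))) has_derivative (D t x \<xi> \<circ> (\<lambda>s. (s, 0, 0)))) (at t within {0..T})"
      by (rule chain) (auto intro!: derivative_eq_intros simp: zero_prod_def)
    then have "((\<lambda>s. f s x \<xi>) has_derivative (\<lambda>s. D t x \<xi> (s, 0, 0))) (at t within {0..T})"
      by (simp add: o_def)
    moreover have "(\<lambda>s. D t x \<xi> (s, 0, 0)) = (\<lambda>s. s *\<^sub>R D t x \<xi> (1, 0, 0))"
    proof
      fix s show "D t x \<xi> (s, 0, 0) = s *\<^sub>R D t x \<xi> (1, 0, 0)"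
        using linear_scale[OF lin, of s "(1, 0, 0)"] by simp
    qed
    ultimately have "((\<lambda>s. f s x \<xi>) has_vector_derivative D t x \<xi> (1, 0, 0)) (at t within {0..T})"
      unfolding has_vector_derivative_def by (rule subst[rotated])
    then have dt: "vector_derivative (\<lambda>s. f s x \<xi>) (at t within {0..T}) = D t x \<xi> (1, 0, 0)"
      using T t vector_derivative_within_closed_interval by blast
    have "((?g \<circ> (\<lambda>y. (t, y, \<xi>))) has_derivative (D t x \<xi> \<circ> (\<lambda>y. (0, y, 0)))) (at x within UNIV)"
      using t by (intro chain) (auto intro!: derivative_eq_intros simp: zero_prod_def)
    then have dx: "vel \<xi> \<bullet> grad (\<lambda>y. f t y \<xi>) x = D t x \<xi> (0, vel \<xi>, 0)"
      by (subst inner_grad[where g' = "D t x \<xi> \<circ> (\<lambda>y. (0, y, 0))"]) (simp_all add: o_def)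
    have "((?g \<circ> (\<lambda>\<eta>. (t, x, \<eta>))) has_derivative (D t x \<xi> \<circ> (\<lambda>\<eta>. (0, 0, \<eta>)))) (at \<xi> within UNIV)"
      using t by (intro chain) (auto intro!: derivative_eq_intros simp: zero_prod_def)
    then have d\<xi>: "?K \<bullet> grad (\<lambda>\<eta>. f t x \<eta>) \<xi> = D t x \<xi> (0, 0, ?K)"
      by (subst inner_grad[where g' = "D t x \<xi> \<circ> (\<lambda>\<eta>. (0, 0, \<eta>))"]) (simp_all add: o_def)
    have "D t x \<xi> (1, vel \<xi>, ?K) = D t x \<xi> (1, 0, 0) + D t x \<xi> (0, vel \<xi>, 0) + D t x \<xi> (0, 0, ?K)"
      by (simp add: linear_add[OF lin, symmetric])
    also have "\<dots> = 0"
      using sol t unfolding smooth_solution_def dt[symmetric] dx[symmetric] d\<xi>[symmetric] by blast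
    finally show ?thesis .
  qed
  with der show ?thesis using that by blast
qed

lemma smooth_solution_le_initial_bound:
  assumes sol: "smooth_solution \<rho> U0 {0..T} f E B" and T: "0 < T"
    and init: "\<And>x \<xi>. f 0 x \<xi> \<le> M" and M: "0 \<le> M" and t: "t \<in> {0..T}"
  shows "f t x \<xi> \<le> M"
proof -
  obtain D where D:
    "\<And>t x \<xi>. t \<in> {0..T} \<Longrightarrow>
      ((\<lambda>(t, x, \<xi>). f t x \<xi>) has_derivative D t x \<xi>) (at (t, x, \<xi>) within {0..T} \<times> UNIV \<times> UNIV)"
    "\<And>t x \<xi>. t \<in> {0..T} \<Longrightarrow> D t x \<xi> (1, vel \<xi>, E t x + cross3 (vel \<xi>) (B t x)) = 0"
    using smooth_solution_transport[OF sol T] by blast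
  have "\<forall>s\<in>{0..T}. \<exists>R. \<forall>t\<in>{0..s}. \<forall>x \<xi>. R \<le> norm \<xi> \<longrightarrow> f t x \<xi> = 0"
    using sol by (simp add: smooth_solution_def)
  \<comment> \<open>Taking \<open>s = T\<close> gives one radius for the whole time interval.\<close>
  then obtain R where "\<And>t x \<xi>. t \<in> {0..T} \<Longrightarrow> R \<le> norm \<xi> \<Longrightarrow> f t x \<xi> = 0"
    using T by (metis atLeastAtMost_iff less_eq_real_def order_refl)
  then show ?thesis
    using transport_maximum_principle[of T f D vel "\<lambda>t x \<xi>. E t x + cross3 (vel \<xi>) (B t x)" R M t x \<xi>]
      D norm_vel_le_1 init M t by blast
qed

text \<open>The set where a continuous function exceeds its essential bound is open and Lebesgue
  null, hence empty.\<close>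

lemma continuous_norm_le_of_Linf_norm_le:
  fixes g :: "'a::euclidean_space \<Rightarrow> 'b::real_normed_vector"
  assumes cont: "continuous_on UNIV g" and bound: "Linf_norm lebesgue g \<le> ennreal c" and c: "0 \<le> c"
  shows "norm (g x) \<le> c"
proof (rule ccontr)
  assume "\<not> norm (g x) \<le> c"
  then have "x \<in> {y. c < norm (g y)}" by simp
  then have ne: "{y. c < norm (g y)} \<noteq> {}" by blast
  have op: "open {y. c < norm (g y)}" using cont by (intro open_Collect_less continuous_intros)
  have "AE y in lebesgue. ennreal (norm (g y)) \<le> Linf_norm lebesgue g"
    unfolding Linf_norm_def by (rule esssup_AE)
  then have "AE y in lebesgue. y \<notin> {y. c < norm (g y)}"
  proof eventually_elim
    case (elim y)
    then have "ennreal (norm (g y)) \<le> ennreal c" using bound by (rule order_trans)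
    with c show ?case by (simp add: ennreal_le_iff)
  qed
  then have "negligible {y. c < norm (g y)}"
    using op by (simp add: negligible_iff_null_sets AE_iff_null_sets)
  with open_not_negligible[OF op ne] show False by simp
qed

section \<open>Momentum averages\<close>

text \<open>The infimum need not be attained, so the conclusion requires \<open>r < norm \<xi>\<close> strictly.\<close>

lemma eq_0_outside_momentum_radius:
  assumes "momentum_radius f t \<le> ereal r" and "r < norm \<xi>"
  shows "f t x \<xi> = 0"
proof -
  have "momentum_radius f t < ereal (norm \<xi>)" using assms by (simp add: order_le_less_trans)
  then show ?thesis unfolding momentum_radius_def Inf_less_iff by auto
qed

lemma Linf_norm_lebesgue_on_le:
  fixes g :: "'a::euclidean_space \<Rightarrow> 'b::real_normed_vector"
  assumes "g \<in> borel_measurable lebesgue" and S: "S \<in> sets lebesgue"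
  shows "Linf_norm (lebesgue_on S) g \<le> Linf_norm lebesgue g"
  unfolding Linf_norm_def
proof (rule esssup_I)
  have "AE x in lebesgue. ennreal (norm (g x)) \<le> esssup lebesgue (\<lambda>x. ennreal (norm (g x)))"
    by (rule esssup_AE)
  then show "AE x in lebesgue_on S. ennreal (norm (g x)) \<le> esssup lebesgue (\<lambda>x. ennreal (norm (g x)))"
    using S by (subst AE_restrict_space_iff) auto
  show "(\<lambda>x. ennreal (norm (g x))) \<in> borel_measurable (lebesgue_on S)"
    using assms(1) by (intro measurable_restrict_space1) measurable
qed

lemma norm_integral_cball_le:
  fixes g :: "R3 \<Rightarrow> real" and G :: "R3 \<Rightarrow> 'b::{banach, second_countable_topology}"
  assumes bound: "\<And>\<xi>. \<bar>g \<xi>\<bar> \<le> M" and supp: "\<And>\<xi>. r < norm \<xi> \<Longrightarrow> g \<xi> = 0" and r: "0 \<le> r"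
  shows "ennreal (norm (\<integral>\<xi>. g \<xi> *\<^sub>R G \<xi> \<partial>lebesgue))
      \<le> ennreal (4 / 3 * pi * M * r ^ 3) * Linf_norm (lebesgue_on (cball 0 r)) G"
proof -
  let ?B = "cball (0::R3) r" and ?L = "Linf_norm (lebesgue_on (cball 0 r)) G"
  have M: "0 \<le> M" using bound[of 0] by linarith
  have "AE \<xi> in lebesgue_on ?B. ennreal (norm (G \<xi>)) \<le> ?L"
    unfolding Linf_norm_def by (rule esssup_AE)
  then have "AE \<xi> in lebesgue. \<xi> \<in> ?B \<longrightarrow> ennreal (norm (G \<xi>)) \<le> ?L"
    by (subst (asm) AE_restrict_space_iff) auto
  then have AE: "AE \<xi> in lebesgue. ennreal (norm (g \<xi> *\<^sub>R G \<xi>)) \<le> (ennreal M * ?L) * indicator ?B \<xi>"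
  proof eventually_elim
    case (elim \<xi>)
    show ?case
    proof (cases "\<xi> \<in> ?B")
      case True
      then have "ennreal (norm (G \<xi>)) \<le> ?L" using elim by simp
      moreover have "ennreal \<bar>g \<xi>\<bar> \<le> ennreal M" using bound M by (simp add: ennreal_le_iff)
      ultimately show ?thesis using True by (simp add: ennreal_mult mult_mono)
    qed (use supp in auto)
  qed
  \<comment> \<open>In the non-integrable case the Bochner integral on the left is \<open>0\<close>.\<close>
  have "ennreal (norm (\<integral>\<xi>. g \<xi> *\<^sub>R G \<xi> \<partial>lebesgue)) \<le> (\<integral>\<^sup>+\<xi>. ennreal (norm (g \<xi> *\<^sub>R G \<xi>)) \<partial>lebesgue)"
    by (cases "integrable lebesgue (\<lambda>\<xi>. g \<xi> *\<^sub>R G \<xi>)")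
      (auto intro: integral_norm_bound_ennreal simp: not_integrable_integral_eq simp del: norm_scaleR)
  also have "\<dots> \<le> (\<integral>\<^sup>+\<xi>. (ennreal M * ?L) * indicator ?B \<xi> \<partial>lebesgue)"
    by (rule nn_integral_mono_AE[OF AE])
  also have "\<dots> = (ennreal M * ?L) * emeasure lebesgue ?B"
    by (rule nn_integral_cmult_indicator) simp
  also have "emeasure lebesgue ?B = ennreal (4 / 3 * pi * r ^ 3)"
    using emeasure_cball[OF r, of "0::R3"] by (simp add: unit_ball_vol_3)
  also have "(ennreal M * ?L) * ennreal (4 / 3 * pi * r ^ 3) = ennreal (4 / 3 * pi * M * r ^ 3) * ?L"
  proof -
    have "ennreal (4 / 3 * pi * M * r ^ 3) = ennreal M * ennreal (4 / 3 * pi * r ^ 3)"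
      using M r by (subst ennreal_mult[symmetric]) (auto simp: mult_ac)
    then show ?thesis by (simp add: mult_ac)
  qed
  finally show ?thesis .
qed

section \<open>The bound on macroscopic quantities\<close>

theorem corollary11:
  fixes P0 p S0 :: real
    and \<rho> :: "real ^ 3 \<Rightarrow> real"
    and \<T> :: "real \<Rightarrow> real" and \<F> :: "real \<Rightarrow> real \<Rightarrow> real"
    and U0 :: data
    and f :: "real \<Rightarrow> real ^ 3 \<Rightarrow> real ^ 3 \<Rightarrow> real"
    and E B :: "real \<Rightarrow> real ^ 3 \<Rightarrow> real ^ 3"
    and G :: "real ^ 3 \<Rightarrow> real ^ 'q"
  assumes "0 \<le> P0" and "3 / 2 < p" and "p \<le> 2" and "0 < S0"
    and "\<rho> \<in> C1c" and "\<forall>x. 0 \<le> \<rho> x"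
    and "momentum_control \<rho> P0 p S0 (\<T> S0) (\<F> S0)"
    and "U0 \<in> \<NN> P0" and "admissible \<rho> U0" and "\<N> p U0 \<le> ennreal S0"
    and "maximal_solution \<rho> U0 f E B"
    and "smooth_solution \<rho> U0 {0..\<T> S0} f E B"
    and "G \<in> Linf"
  shows "\<forall>t\<in>{0..\<T> S0}. \<forall>x.
    ennreal (norm (macroscopic G f t x))
      \<le> ennreal (4 * pi * S0 * \<F> S0 t ^ 3) * Linf_norm (lebesgue_on (cball 0 (\<F> S0 t))) G \<and>
    ennreal (4 * pi * S0 * \<F> S0 t ^ 3) * Linf_norm (lebesgue_on (cball 0 (\<F> S0 t))) G < \<infinity>"
proof (intro ballI allI)
  fix t x
  assume t: "t \<in> {0..\<T> S0}"
  note sol = \<open>smooth_solution \<rho> U0 {0..\<T> S0} f E B\<close>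
  note control = \<open>momentum_control \<rho> P0 p S0 (\<T> S0) (\<F> S0)\<close>
  have T: "0 < \<T> S0" and mono: "mono_on {0..\<T> S0} (\<F> S0)" and F: "0 \<le> \<F> S0 t"
    using control t by (auto simp: momentum_control_def)
  have U0: "U0 = (f 0, E 0, B 0)" using sol by (simp add: smooth_solution_def)

  have "f 0 x \<xi> \<le> S0" for x \<xi>
  proof -
    let ?f0 = "\<lambda>(x, \<xi>). f 0 x \<xi>"
    have "C1_on UNIV ?f0" using \<open>U0 \<in> \<NN> P0\<close> by (simp add: U0 data_class_def C1c_def)
    then have "continuous_on UNIV ?f0"
      by (rule C1_on_imp_continuous_on)
    moreover have "Linf_norm lebesgue ?f0 \<le> \<N> p U0"
      unfolding data_norm_def U0 by (simp add: add.assoc)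
    then have "Linf_norm lebesgue ?f0 \<le> ennreal S0"
      using \<open>\<N> p U0 \<le> ennreal S0\<close> by (rule order_trans)
    ultimately have "norm (?f0 (x, \<xi>)) \<le> S0"
      using \<open>0 < S0\<close> continuous_norm_le_of_Linf_norm_le[of ?f0 S0 "(x, \<xi>)"] by simp
    then show ?thesis by simp
  qed
  then have upper: "f t x \<xi> \<le> S0" for \<xi>
    using smooth_solution_le_initial_bound[OF sol T] t \<open>0 < S0\<close> by simp
  have lower: "0 \<le> f t x \<xi>" for \<xi> using sol t by (simp add: smooth_solution_def)

  have before: "f s x \<xi> = 0" if "0 \<le> s" "s < \<T> S0" "\<F> S0 s < norm \<xi>" for s \<xi>
  proof -
    have "ereal (\<T> S0) \<le> lifespan \<rho> U0"
      and "\<forall>t. 0 \<le> t \<and> ereal t < min (lifespan \<rho> U0) (ereal (\<T> S0)) \<longrightarrow>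
              momentum_radius f t \<le> ereal (\<F> S0 t)"
      using control assms unfolding momentum_control_def by blast+
    moreover from this(1) that have "ereal s < lifespan \<rho> U0"
      by (meson ereal_less_eq(3) less_ereal.simps(1) order_less_le_trans)
    ultimately have "momentum_radius f s \<le> ereal (\<F> S0 s)" using that by simp
    then show ?thesis using eq_0_outside_momentum_radius that by blast
  qed
  have vanish: "f t x \<xi> = 0" if \<xi>: "\<F> S0 t < norm \<xi>" for \<xi>
  proof (cases "t = \<T> S0")
    case False
    then show ?thesis using before t \<xi> by simp
  next
    case True
    \<comment> \<open>The lifespan may equal \<open>\<T> S0\<close>, and then the momentum radius is not controlled at the end
      point; the values at earlier times determine \<open>f\<close> there.\<close>
    have "C1_on ({0..\<T> S0} \<times> UNIV \<times> UNIV) (\<lambda>(t, x, \<xi>). f t x \<xi>)"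
      using sol by (simp add: smooth_solution_def)
    then have "continuous_on ({0..\<T> S0} \<times> UNIV \<times> UNIV) (\<lambda>(t, x, \<xi>). f t x \<xi>)"
      by (rule C1_on_imp_continuous_on)
    then have "continuous_on {0..\<T> S0} (\<lambda>s. (\<lambda>(t, x, \<xi>). f t x \<xi>) (s, x, \<xi>))"
      by (rule continuous_on_compose2) (auto intro!: continuous_intros)
    then have "continuous_on {0..\<T> S0} (\<lambda>s. f s x \<xi>)" by simp
    moreover have "f s x \<xi> = 0" if "s \<in> {0..<\<T> S0}" for s
    proof -
      have "\<F> S0 s \<le> \<F> S0 t" using mono_onD[OF mono] that t True by auto
      with before[of s] that \<xi> show ?thesis by auto
    qed
    moreover have "closure {0..<\<T> S0} = {0..\<T> S0}" using T by simp
    ultimately show ?thesis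
      using continuous_constant_on_closure[of "{0..<\<T> S0}" "\<lambda>s. f s x \<xi>" 0 t] t by metis
  qed

  let ?L = "Linf_norm (lebesgue_on (cball 0 (\<F> S0 t))) G"
  have "ennreal (norm (macroscopic G f t x)) \<le> ennreal (4 / 3 * pi * S0 * \<F> S0 t ^ 3) * ?L"
    unfolding macroscopic_def
    using lower upper vanish F by (intro norm_integral_cball_le) simp_all
  also have "\<dots> \<le> ennreal (4 * pi * S0 * \<F> S0 t ^ 3) * ?L"
    using F \<open>0 < S0\<close> by (intro mult_right_mono ennreal_leI) auto
  finally have "ennreal (norm (macroscopic G f t x)) \<le> ennreal (4 * pi * S0 * \<F> S0 t ^ 3) * ?L" .
  moreover have "?L \<le> Linf_norm lebesgue G"
    using \<open>G \<in> Linf\<close> by (intro Linf_norm_lebesgue_on_le) (auto simp: Linf_def)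
  then have "?L < \<infinity>" using \<open>G \<in> Linf\<close> by (auto simp: Linf_def intro: order_le_less_trans)
  then have "ennreal (4 * pi * S0 * \<F> S0 t ^ 3) * ?L < \<infinity>"
    by (simp add: ennreal_mult_less_top)
  ultimately show "ennreal (norm (macroscopic G f t x)) \<le> ennreal (4 * pi * S0 * \<F> S0 t ^ 3) * ?L \<and>
      ennreal (4 * pi * S0 * \<F> S0 t ^ 3) * ?L < \<infinity>" by blast
qed

end
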